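(* Let $n\geq 1$ and $0\leq j\leq n$ be integers. Then the number of northeastern lattice paths from $(0,0)$ to $(n,n)$ enclosing an area congruent to $j$ modulo $n+1$ is equal to $C_n=\frac{1}{n+1}\binom{2n}{n}$, which in particular is independent of $j$.
   Context: A northeastern lattice path from $(0,0)$ to $(a,b)$ (with $a,b$ nonnegative integers) is a sequence of $a+b$ unit steps, each equal to $(1,0)$ (east) or $(0,1)$ (north), starting at $(0,0)$ and ending at $(a,b)$; so exactly $a$ steps are east and $b$ steps are north. The area enclosed by such a path is the area of the region of the rectangle $[0,a]\times[0,b]$ lying below (and to the right of) the path, i.e. the sum over all east steps of the $y$-coordinate at which the step is taken. Equivalently, it is the number of pairs consisting of a north step and a later east step. $C_n$ denotes the $n$th Catalan number. *)

theory Defs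
  imports Complex_Main "HOL-Library.Product_Plus" "HOL-Number_Theory.Cong"
begin

abbreviation east :: "nat \<times> nat" where
  "east \<equiv> (1, 0)"

abbreviation north :: "nat \<times> nat" where
  "north \<equiv> (0, 1)"

(* A path starting at (0,0) is its list of steps; the partial sums are the points visited. *)
definition ne_paths :: "nat \<Rightarrow> nat \<Rightarrow> (nat \<times> nat) list set" where
  "ne_paths a b =
     {p. set p \<subseteq> {east, north} \<and> length p = a + b \<and> sum_list p = (a, b)}"

(* Each east step at height y contributes a column of unit width and height y below the path. *)
definition area :: "(nat \<times> nat) list \<Rightarrow> nat" where
  "area p = (\<Sum>i | i < length p \<and> p ! i = east. snd (sum_list (take i p)))"

(* The division is exact. *)
definition catalan :: "nat \<Rightarrow> nat" where
  "catalan n = ((2 * n) choose n) div (n + 1)"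

end

theory Submission
  imports Defs "HOL-Combinatorics.Multiset_Permutations"
begin

text \<open>
  A path to \<open>(a, b)\<close> amounts to the numbers \<open>k\<^sub>0, \<dots>, k\<^sub>b\<close> of east steps taken at
  the heights \<open>0, \<dots>, b\<close>; these add up to \<open>a\<close>, and the area is the sum of the products
  \<open>i * k\<^sub>i\<close>.  Rotate this sequence by one place: every east step goes down by one, except that
  the ones at height \<open>0\<close> go up to height \<open>b\<close>, which is also \<open>-1\<close> modulo \<open>b + 1\<close>.
  So rotation changes the area by \<open>-a\<close> modulo \<open>b + 1\<close>, which for \<open>a = b = n\<close> is
  \<open>+1\<close> modulo \<open>n + 1\<close>.  Being injective, rotation carries each residue class of the area into
  the next one, and as the classes are arranged in a cycle they all have the same size, namely
  \<open>(2 * n) choose n\<close> divided by \<open>n + 1\<close>.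

  On words, rotation takes \<open>E\<dots>E N r\<close> to \<open>r N E\<dots>E\<close> (\<open>rotate_row\<close>); its effect on the area
  is \<open>area_rotate_row\<close>, and the cyclic counting argument is \<open>card_residue_class\<close>.
\<close>

section \<open>Weights raised by one modulo \<open>m\<close>\<close>

text \<open>An injective map that raises the weight by one embeds each residue class into the next.
  Going round the cycle of \<open>m\<close> classes, no class can be larger than another, so all of them
  have the same share of \<open>P\<close>.\<close>

lemma card_residue_class:
  fixes w :: "'a \<Rightarrow> nat"
  assumes "finite P" and "m > 0" and inj: "inj_on f P" and closed: "f ` P \<subseteq> P"
    and step: "\<And>p. p \<in> P \<Longrightarrow> [w (f p) = w p + 1] (mod m)"
  shows "m * card {p \<in> P. [w p = j] (mod m)} = card P"
proof -
  define c where "c i = card {p \<in> P. [w p = i] (mod m)}" for i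
  have mono: "c i \<le> c (Suc i)" for i
    unfolding c_def
  proof (rule card_inj_on_le)
    show "inj_on f {p \<in> P. [w p = i] (mod m)}"
      using inj by (rule inj_on_subset) auto
    show "f ` {p \<in> P. [w p = i] (mod m)} \<subseteq> {p \<in> P. [w p = Suc i] (mod m)}"
    proof clarify
      fix p assume "p \<in> P" and "[w p = i] (mod m)"
      from this(2) have "[w p + 1 = i + 1] (mod m)"
        by (rule cong_add) simp
      with step[OF \<open>p \<in> P\<close>] have "[w (f p) = Suc i] (mod m)"
        using cong_trans by fastforce
      with closed \<open>p \<in> P\<close> show "f p \<in> P \<and> [w (f p) = Suc i] (mod m)"
        by blast
    qed
    show "finite {p \<in> P. [w p = Suc i] (mod m)}"
      using \<open>finite P\<close> by simp
  qed
  have periodic: "c (i mod m) = c i" for i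
    by (simp add: c_def cong_def)
  have const: "c i = c (j mod m)" if "i < m" for i
  proof (rule antisym)
    \<comment> \<open>A monotone periodic sequence is constant.\<close>
    have "c i \<le> c (j mod m + m)"
      using that by (intro lift_Suc_mono_le[of c, OF mono]) simp
    also have "\<dots> = c (j mod m)"
      using periodic[of "j mod m + m"] by simp
    finally show "c i \<le> c (j mod m)" .
    have "c (j mod m) \<le> c (i + m)"
      using \<open>m > 0\<close> by (intro lift_Suc_mono_le[of c, OF mono]) (simp add: less_imp_le trans_le_add2)
    also have "\<dots> = c i"
      using periodic[of "i + m"] periodic[of i] by simp
    finally show "c (j mod m) \<le> c i" .
  qed
  have "card P = (\<Sum>i<m. card {p \<in> P. w p mod m = i})"
    using \<open>finite P\<close> \<open>m > 0\<close> sum_fun_comp[of P "{..<m}" "\<lambda>p. w p mod m" "\<lambda>_. 1 :: nat"]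
    by (force simp: image_subset_iff)
  also have "\<dots> = (\<Sum>i<m. c i)"
    by (intro sum.cong) (auto simp: c_def cong_def)
  also have "\<dots> = m * c j"
    using const periodic[of j] by simp
  finally show ?thesis
    by (simp add: c_def)
qed

section \<open>Paths as permutations of a multiset\<close>

text \<open>Rewriting \<open>1\<close> to \<open>Suc 0\<close> would hide the steps \<open>(1, 0)\<close> and \<open>(0, 1)\<close> from
  the equations about them.\<close>

declare One_nat_def [simp del]

text \<open>Describing paths by the multiset of their steps makes rearranging a path harmless, and
  reduces counting paths to counting the permutations of a multiset.\<close>

lemma ne_paths_eq_permutations:
  "ne_paths a b = permutations_of_multiset (replicate_mset a east + replicate_mset b north)"
proof (intro set_eqI iffI)
  fix p assume "p \<in> ne_paths a b"
  then have "set p \<subseteq> {east, north}" and "sum_list p = (a, b)"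
    by (auto simp: ne_paths_def)
  then have "mset p = replicate_mset a east + replicate_mset b north"
  proof (induction p arbitrary: a b)
    case Nil
    then show ?case by (simp add: zero_prod_def)
  next
    case (Cons s p)
    obtain a' b' where ab': "sum_list p = (a', b')" by fastforce
    with Cons show ?case by (auto simp: Suc_eq_plus1_left[symmetric])
  qed
  then show "p \<in> permutations_of_multiset (replicate_mset a east + replicate_mset b north)"
    by (simp add: permutations_of_multiset_def)
next
  fix p assume "p \<in> permutations_of_multiset (replicate_mset a east + replicate_mset b north)"
  then have p: "mset p = replicate_mset a east + replicate_mset b north"
    by (simp add: permutations_of_multiset_def)
  have east: "sum_mset (replicate_mset k east) = (k, 0)" for k
    by (induction k) (auto simp: zero_prod_def)
  have north: "sum_mset (replicate_mset k north) = (0, k)" for k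
    by (induction k) (auto simp: zero_prod_def)
  have "set p \<subseteq> {east, north}"
    using arg_cong[OF p, of set_mset] by (auto split: if_splits)
  moreover have "length p = a + b"
    using arg_cong[OF p, of size] by simp
  moreover have "sum_list p = (a, b)"
    using arg_cong[OF p, of sum_mset] by (simp add: east north sum_mset_sum_list)
  ultimately show "p \<in> ne_paths a b"
    by (simp add: ne_paths_def)
qed

lemma finite_ne_paths: "finite (ne_paths a b)"
  by (simp add: ne_paths_eq_permutations)

lemma card_ne_paths: "card (ne_paths a b) = (a + b) choose a"
proof -
  let ?M = "replicate_mset a east + replicate_mset b north"
  have "set_mset ?M \<subseteq> {east, north}"
    by auto
  then have "(\<Prod>s\<in>set_mset ?M. fact (count ?M s)) = (\<Prod>s\<in>{east, north}. fact (count ?M s) :: nat)"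
    by (intro prod.mono_neutral_left) (auto simp: not_in_iff)
  also have "\<dots> = fact a * fact b"
    by simp
  finally show ?thesis
    by (simp add: ne_paths_eq_permutations card_permutations_of_multiset binomial_fact')
qed

lemma sum_list_replicate_east: "sum_list (replicate k east) = (k, 0)"
  by (induction k) (auto simp: zero_prod_def)

section \<open>Area of a concatenation\<close>

lemma area_Nil: "area [] = 0"
  by (simp add: area_def)

lemma area_snoc: "area (p @ [s]) = area p + (if s = east then snd (sum_list p) else 0)"
proof -
  let ?I = "{i. i < length p \<and> p ! i = east}"
  have "{i. i < length (p @ [s]) \<and> (p @ [s]) ! i = east} =
      ?I \<union> (if s = east then {length p} else {})"
    by (auto simp: nth_append less_Suc_eq)
  moreover have "(\<Sum>i\<in>?I. snd (sum_list (take i (p @ [s])))) = area p"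
    by (simp add: area_def)
  ultimately show ?thesis
    by (simp add: area_def)
qed

text \<open>Following \<open>q\<close> after \<open>p\<close> lifts all east steps of \<open>q\<close> by the height that \<open>p\<close>
  reaches.\<close>

lemma area_append:
  "area (p @ q) = area p + area q + snd (sum_list p) * count_list q east"
proof (induction q rule: rev_induct)
  case Nil
  show ?case by (simp add: area_Nil)
next
  case (snoc s q)
  then show ?case
    using area_snoc[of "p @ q" s] by (simp add: area_snoc algebra_simps)
qed

lemma area_replicate_east: "area (replicate k east) = 0"
  by (auto simp: area_def sum_list_replicate_east min_def)

section \<open>Moving the bottom row to the top\<close>

definition rotate_row :: "(nat \<times> nat) list \<Rightarrow> (nat \<times> nat) list" where
  "rotate_row p =
     tl (dropWhile (\<lambda>s. s = east) p) @ north # takeWhile (\<lambda>s. s = east) p"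

lemma rotate_row_replicate: "rotate_row (replicate k east @ north # r) = r @ north # replicate k east"
proof -
  have "takeWhile (\<lambda>s. s = east) (replicate k east @ north # r) = replicate k east"
    by (induction k) auto
  moreover have "dropWhile (\<lambda>s. s = east) (replicate k east @ north # r) = north # r"
    by (induction k) auto
  ultimately show ?thesis
    by (simp add: rotate_row_def)
qed

lemma ne_paths_first_north:
  assumes "p \<in> ne_paths a b" and "b > 0"
  obtains k r where "p = replicate k east @ north # r"
proof -
  have "mset p = replicate_mset a east + replicate_mset b north"
    using assms by (simp add: ne_paths_eq_permutations permutations_of_multiset_def)
  from arg_cong[OF this, of set_mset] have "set p \<subseteq> {east, north}" and "north \<in> set p"
    using \<open>b > 0\<close> by (auto split: if_splits)
  then have "\<exists>k r. p = replicate k east @ north # r"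
  proof (induction p)
    case (Cons s p)
    show ?case
    proof (cases "s = north")
      case True
      then have "s # p = replicate 0 east @ north # p" by simp
      then show ?thesis by blast
    next
      case False
      with Cons obtain k r where "p = replicate k east @ north # r" and "s = east" by auto
      then have "s # p = replicate (Suc k) east @ north # r" by simp
      then show ?thesis by blast
    qed
  qed simp
  then show thesis using that by blast
qed

lemma rotate_row_in_ne_paths:
  assumes "p \<in> ne_paths a b" and "b > 0"
  shows "rotate_row p \<in> ne_paths a b"
proof -
  obtain k r where p: "p = replicate k east @ north # r"
    using assms by (rule ne_paths_first_north)
  have "mset (rotate_row p) = mset p"
    unfolding p rotate_row_replicate by simp
  with assms show ?thesis
    by (simp add: ne_paths_eq_permutations permutations_of_multiset_def)
qed

text \<open>Read backwards, a rotated path shows what was moved: its final run of east steps is the bottom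
  row of the original path.\<close>

lemma inj_on_rotate_row:
  assumes "b > 0"
  shows "inj_on rotate_row (ne_paths a b)"
proof (rule inj_onI)
  fix p q assume p: "p \<in> ne_paths a b" and q: "q \<in> ne_paths a b"
    and eq: "rotate_row p = rotate_row q"
  obtain k r where pk: "p = replicate k east @ north # r"
    using p assms by (rule ne_paths_first_north)
  obtain l s where ql: "q = replicate l east @ north # s"
    using q assms by (rule ne_paths_first_north)
  have "rev (r @ north # replicate k east) = rev (s @ north # replicate l east)"
    using eq by (simp add: pk ql rotate_row_replicate)
  then have *: "replicate k east @ north # rev r = replicate l east @ north # rev s"
    by simp
  have "k = l"
    using arg_cong[OF *, of "\<lambda>x. length (takeWhile (\<lambda>t. t = east) x)"]
    by (simp add: takeWhile_append)
  with * show "p = q"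
    by (simp add: pk ql)
qed

text \<open>The bottom row of length \<open>k\<close> rises by \<open>b\<close>, the other \<open>a - k\<close> east steps drop by one: the
  area changes by \<open>k * b - (a - k)\<close>, that is, by \<open>k * (b + 1) - a\<close>.\<close>

lemma area_rotate_row:
  assumes "p \<in> ne_paths a b" and "b > 0"
  shows "[area (rotate_row p) + a = area p] (mod (b + 1))"
proof -
  obtain k r where p: "p = replicate k east @ north # r"
    using assms by (rule ne_paths_first_north)
  have mset_p: "mset p = replicate_mset a east + replicate_mset b north"
    using assms by (simp add: ne_paths_eq_permutations permutations_of_multiset_def)
  have a: "a = k + count_list r east"
    using arg_cong[OF mset_p, of "\<lambda>M. count M east"] by (simp add: p count_mset)
  have "snd (sum_list p) = b"
    using assms by (simp add: ne_paths_def)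
  then have b: "b = Suc (snd (sum_list r))"
    by (simp add: p sum_list_replicate_east)
  have area_north: "area [north] = 0"
    using area_snoc[of "[]" north] by (simp add: area_Nil)
  have area_p: "area p = area r + count_list r east"
    using area_append[of "replicate k east" "north # r"] area_append[of "[north]" r]
    by (simp add: p area_replicate_east area_north sum_list_replicate_east)
  have count_east: "count_list (replicate k east) east = k"
    by (induction k) auto
  have "area (rotate_row p) = area r + b * k"
    using area_append[of "r @ [north]" "replicate k east"] area_append[of r "[north]"]
    by (simp add: p rotate_row_replicate area_replicate_east area_north b count_east algebra_simps)
  then have "area (rotate_row p) + a = area p + k * (b + 1)"
    by (simp add: area_p a algebra_simps)
  then show ?thesis
    by (simp add: cong_def)
qed

section \<open>Equidistribution of the area\<close>

theorem theorem7:
  fixes n j :: nat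
  assumes "n \<ge> 1" and "j \<le> n"
  shows "card {p \<in> ne_paths n n. [area p = j] (mod (n + 1))} = catalan n
         \<and> real (catalan n) = 1 / (real n + 1) * real ((2 * n) choose n)"
proof -
  let ?c = "card {p \<in> ne_paths n n. [area p = j] (mod (n + 1))}"
  have "n > 0"
    using assms by simp
  have "[area (rotate_row p) = area p + 1] (mod (n + 1))" if "p \<in> ne_paths n n" for p
  proof -
    have "[(area (rotate_row p) + n) + 1 = area p + 1] (mod (n + 1))"
      using area_rotate_row[OF that \<open>n > 0\<close>] by (rule cong_add) simp
    then have "[area (rotate_row p) + (n + 1) = area p + 1] (mod (n + 1))"
      by (simp only: add.assoc)
    then show ?thesis
      by (simp only: cong_def mod_add_self2)
  qed
  then have "(n + 1) * ?c = card (ne_paths n n)"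
    using \<open>n > 0\<close> finite_ne_paths inj_on_rotate_row rotate_row_in_ne_paths
    by (intro card_residue_class[where f = rotate_row]) auto
  also have "\<dots> = (2 * n) choose n"
    by (simp only: card_ne_paths mult_2)
  finally have total: "(n + 1) * ?c = (2 * n) choose n" .
  then have c: "catalan n = ?c"
    unfolding catalan_def using nonzero_mult_div_cancel_left[of "n + 1" ?c] by simp
  have "(real n + 1) * real ?c = real ((2 * n) choose n)"
    using arg_cong[OF total, of real] by (simp add: add.commute)
  then have "real ?c = 1 / (real n + 1) * real ((2 * n) choose n)"
    by (simp add: field_simps)
  with c show ?thesis
    by simp
qed

end
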